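(* Let $f_1,\dots,f_m:\mathbb{R}^n\to\mathbb{R}$ and $g_1,\dots,g_l:\mathbb{R}^n\to\mathbb{R}$ be convex functions, and consider the problem (CMOP) of minimizing $f=(f_1,\dots,f_m)$ over $X=\{x\in\mathbb{R}^n: g_r(x)\le 0,\ r=1,\dots,l\}$. Let $\epsilon\in\mathbb{R}^m_+$ and $\hat M>0$ be given, and assume that CMOP satisfies the Slater constraint qualification. Write $I=\{1,\dots,m\}$. If $x_0\in\mathcal{G}_{\hat M,\epsilon}(f,X)$, then for each $i\in I$ there exist $\bar\tau^i\in S^m$ and $\bar\mu^i\in\mathbb{R}^l_+$ such that for all $x\in\mathbb{R}^n$ and all $\mu\in\mathbb{R}^l_+$: (i) $L_i^{\hat M}(x_0,\bar\tau^i,\mu)-\bar\epsilon_i\le L_i^{\hat M}(x_0,\bar\tau^i,\bar\mu^i)\le L_i^{\hat M}(x,\bar\tau^i,\bar\mu^i)+\bar\epsilon_i$; (ii) $\sum_{r=1}^l\bar\mu_r^ig_r(x_0)\ge-\bar\epsilon_i$, where $\bar\epsilon_i=\epsilon_i+\sum_{j\in I,\,j\ne i}\bar\tau^i_j\hat M\epsilon_j$. Conversely, if $x_0\in\mathbb{R}^n$ is such that for each $i\in I$ there exists $(\bar\tau^i,\bar\mu^i)\in S^m\times\mathbb{R}^l_+$ such that (i) (for all $x\in\mathbb{R}^n$ and $\mu\in\mathbb{R}^l_+$) and (ii) hold, then $x_0\in\mathcal{G}_{\tilde M,2\epsilon}(f,X)$, where $\tilde M\ge(1+\hat M)(m-1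)$.
   Context: Slater constraint qualification: there exists $\hat x\in X$ with $g_r(\hat x)<0$ for all $r=1,\dots,l$. $\epsilon$-Pareto optimality: for $\epsilon\in\mathbb{R}^m_+$, $\mathcal{S}_\epsilon(f,X)$ is the set of $x^*\in X$ for which there is no $x\in X$ with $f(x)+\epsilon-f(x^* )\in-\mathbb{R}^m_+\setminus\{0\}$. $(M,\epsilon)$-Geoffrion proper solutions: for $\epsilon\in\mathbb{R}^m_+$ and a scalar $M>0$, $\mathcal{G}_{M,\epsilon}(f,X)$ is the set of $x_0\in\mathcal{S}_\epsilon(f,X)$ such that for all $i\in I$ and $x\in X$ satisfying $f_i(x)<f_i(x_0)-\epsilon_i$, there exists $j\in I$ with $f_j(x_0)-\epsilon_j<f_j(x)$ and $$\frac{f_i(x_0)-f_i(x)-\epsilon_i}{f_j(x)-f_j(x_0)+\epsilon_j}\le M.$$ Unit simplex: $S^m=\{x\in\mathbb{R}^m: 0\le x_i\le1\ (i\in I),\ \sum_{i=1}^mx_i=1\}$. $(\hat M,i)$-Lagrangian: for $i\in I$, $x\in\mathbb{R}^n$, $\tau^i=(\tau^i_1,\dots,\tau^i_m)\in S^m$ and $\mu^i=(\mu_1^i,\dots,\mu_l^i)\in\mathbb{R}^l_+$, $$L_i^{\hat M}(x,\tau^i,\mu^i)=f_i(x)+\sum_{j\in I,\,j\ne i}\tau^i_j\hat Mf_j(x)+\sum_{r=1}^l\mu^i_rg_r(x).$$ *)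

theory Defs
  imports "HOL-Analysis.Analysis"
begin

text \<open>
  The problem (CMOP) is given by vector-valued maps \<open>f :: real^'n \<Rightarrow> real^'m\<close> (objectives
  \<open>f x $ i\<close>) and \<open>g :: real^'n \<Rightarrow> real^'l\<close> (constraints \<open>g x $ r \<le> 0\<close>). The index set
  \<open>I = {1,\<dots>,m}\<close> is the finite type \<open>'m\<close>, so that \<open>m = CARD('m)\<close>.
\<close>

definition nonneg_orthant :: "(real^'k) set" where
  "nonneg_orthant = {y. \<forall>i. 0 \<le> y $ i}"

definition feasible_set :: "(real^'n \<Rightarrow> real^'l) \<Rightarrow> (real^'n) set" where
  "feasible_set g = {x. \<forall>r. g x $ r \<le> 0}"

definition slater_cq :: "(real^'n \<Rightarrow> real^'l) \<Rightarrow> bool" where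
  "slater_cq g \<longleftrightarrow> (\<exists>x\<in>feasible_set g. \<forall>r. g x $ r < 0)"

definition eps_pareto ::
    "real^'m \<Rightarrow> (real^'n \<Rightarrow> real^'m) \<Rightarrow> (real^'n) set \<Rightarrow> (real^'n) set" where
  "eps_pareto \<epsilon> f X =
     {xs \<in> X. \<not> (\<exists>x\<in>X. f x + \<epsilon> - f xs \<in> uminus ` nonneg_orthant - {0})}"

text \<open>
  The \<open>(M, \<epsilon>)\<close>-Geoffrion proper solutions are only meant for \<open>M > 0\<close> and \<open>\<epsilon>\<close> in the
  nonnegative orthant. The fraction has a positive denominator by the condition next to it.
\<close>

definition geoffrion_proper ::
    "real \<Rightarrow> real^'m \<Rightarrow> (real^'n \<Rightarrow> real^'m) \<Rightarrow> (real^'n) set \<Rightarrow> (real^'n) set" where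
  "geoffrion_proper M \<epsilon> f X =
     {x0 \<in> eps_pareto \<epsilon> f X.
        \<forall>i. \<forall>x\<in>X. f x $ i < f x0 $ i - \<epsilon> $ i \<longrightarrow>
          (\<exists>j. f x0 $ j - \<epsilon> $ j < f x $ j \<and>
               (f x0 $ i - f x $ i - \<epsilon> $ i) / (f x $ j - f x0 $ j + \<epsilon> $ j) \<le> M)}"

definition unit_simplex :: "(real^'m) set" where
  "unit_simplex = {t. (\<forall>i. 0 \<le> t $ i \<and> t $ i \<le> 1) \<and> (\<Sum>i\<in>UNIV. t $ i) = 1}"

definition lagrangian ::
    "(real^'n \<Rightarrow> real^'m) \<Rightarrow> (real^'n \<Rightarrow> real^'l) \<Rightarrow> real \<Rightarrow> 'm \<Rightarrow>
     real^'n \<Rightarrow> real^'m \<Rightarrow> real^'l \<Rightarrow> real" where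
  "lagrangian f g M i x \<tau> \<mu> =
     f x $ i + (\<Sum>j\<in>UNIV - {i}. \<tau> $ j * M * f x $ j) + (\<Sum>r\<in>UNIV. \<mu> $ r * g x $ r)"

definition eps_bar :: "real \<Rightarrow> real^'m \<Rightarrow> real^'m \<Rightarrow> 'm \<Rightarrow> real" where
  "eps_bar M \<epsilon> \<tau> i = \<epsilon> $ i + (\<Sum>j\<in>UNIV - {i}. \<tau> $ j * M * \<epsilon> $ j)"

end

theory Submission
  imports Defs
begin

text \<open>
  Write \<open>d j = f x $ j - f x0 $ j + \<epsilon> $ j\<close> for the shifted increments from \<open>x0\<close> to \<open>x\<close>. Geoffrion
  properness with bound \<open>M\<close> says that, for each \<open>i\<close>, no feasible \<open>x\<close> satisfies \<open>d i < 0\<close> together with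
  \<open>d i + M * d j < 0\<close> for all \<open>j \<noteq> i\<close>: a loss \<open>- d i\<close> in objective \<open>i\<close> is always paid for, up to
  the factor \<open>M\<close>, by some gain \<open>d j\<close>. Now \<open>d i\<close> and \<open>d i + M * d j\<close> are convex functions of \<open>x\<close>,
  so the inconsistency of this strict system yields multipliers
  (\<open>convex_alternative_slater\<close>, a separation argument). Slater's condition lets the multipliers of the
  objectives be normalised to a point \<open>\<tau>\<close> of the simplex, and since \<open>d i\<close> occurs in every
  inequality of the system, its total weight is exactly one:
  \<open>d i + (\<Sum>j\<noteq>i. \<tau> j * M * d j) + (\<Sum>r. \<mu> r * g r) \<ge> 0\<close> on the whole space
  (\<open>geoffrion_proper_multipliers\<close>). This is the right-hand saddle inequality; evaluated at \<open>x0\<close>,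
  where \<open>d = \<epsilon>\<close>, it is approximate complementary slackness, which implies the left-hand one.

  Conversely, letting \<open>\<mu>\<close> range over the orthant in the left-hand inequality forces \<open>x0\<close> to be
  feasible. The right-hand inequality and approximate complementary slackness each cost one
  \<open>eps_bar\<close>, hence \<open>2 *\<^sub>R \<epsilon>\<close>: the increments shifted by \<open>2 *\<^sub>R \<epsilon>\<close> satisfy
  \<open>d i + (\<Sum>j\<noteq>i. \<tau> j * M * d j) \<ge> 0\<close> for each \<open>i\<close> and feasible \<open>x\<close>. If \<open>d i < 0\<close>, the weighted sum is
  positive and, as the weights add up to at most one, it is at most \<open>M\<close> times the largest \<open>d j\<close>. So
  the trade-off is even bounded by \<open>M\<close>, which is at most \<open>(1 + M) * (m - 1)\<close> once there are at least two
  objectives; with a single objective \<open>d i < 0\<close> cannot occur.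
\<close>

section \<open>A theorem of the alternative for convex functions\<close>

text \<open>
  The set of vectors strictly above some value \<open>h x\<close> is convex and misses \<open>0\<close>, so a hyperplane separates
  it from \<open>0\<close>. The set is upward closed, so the normal is nonnegative, and each
  \<open>h x\<close> is a limit of its members.
\<close>

lemma convex_alternative:
  fixes h :: "'a::real_vector \<Rightarrow> real^'k"
  assumes conv: "\<And>k. convex_on UNIV (\<lambda>x. h x $ k)"
    and inconsistent: "\<not> (\<exists>x. \<forall>k. h x $ k < 0)"
  obtains w where "w \<noteq> 0" "\<And>k. 0 \<le> w $ k" "\<And>x. 0 \<le> (\<Sum>k\<in>UNIV. w $ k * h x $ k)"
proof -
  define C where "C = {y. \<exists>x. \<forall>k. h x $ k < y $ k}"
  have "convex C"
    unfolding convex_alt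
  proof (intro ballI allI impI)
    fix y z :: "real^'k" and u :: real
    assume yz: "y \<in> C" "z \<in> C" and u: "0 \<le> u \<and> u \<le> 1"
    then obtain a b where ab: "\<And>k. h a $ k < y $ k" "\<And>k. h b $ k < z $ k"
      unfolding C_def by blast
    have "h ((1 - u) *\<^sub>R a + u *\<^sub>R b) $ k < ((1 - u) *\<^sub>R y + u *\<^sub>R z) $ k" for k
    proof -
      have "h ((1 - u) *\<^sub>R a + u *\<^sub>R b) $ k \<le> (1 - u) * h a $ k + u * h b $ k"
        using convex_onD[OF conv] u by blast
      also have "\<dots> < (1 - u) * y $ k + u * z $ k"
      proof (cases "u = 0")
        case True
        then show ?thesis using ab by simp
      next
        case False
        then have "u * h b $ k < u * z $ k" using ab u by simp
        moreover have "(1 - u) * h a $ k \<le> (1 - u) * y $ k"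
          using ab(1)[of k] u by (intro mult_left_mono) auto
        ultimately show ?thesis by linarith
      qed
      finally show ?thesis by simp
    qed
    then show "(1 - u) *\<^sub>R y + u *\<^sub>R z \<in> C"
      unfolding C_def by blast
  qed
  moreover have "0 \<notin> C"
    using inconsistent by (simp add: C_def)
  ultimately obtain w where w: "w \<noteq> 0" "\<And>y. y \<in> C \<Longrightarrow> 0 \<le> w \<bullet> y"
    using separating_hyperplane_set_0 by blast
  have above: "0 \<le> w \<bullet> h x + w \<bullet> v" if "\<And>k. 0 < v $ k" for x v
  proof -
    have "h x + v \<in> C"
      unfolding C_def using that by (auto intro!: exI[of _ x])
    then show ?thesis
      using w(2) by (metis inner_add_right)
  qed
  have nonneg: "0 \<le> w $ k" for k
  proof (rule ccontr)
    assume "\<not> 0 \<le> w $ k"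
    then have neg: "w $ k < 0" by simp
    \<comment> \<open>Moving far along axis \<open>k\<close> stays in \<open>C\<close> but makes the inner product negative.\<close>
    define S where "S = w \<bullet> h undefined + w \<bullet> (\<chi> i. 1)"
    define t where "t = (\<bar>S\<bar> + 1) / - w $ k"
    have t: "0 < t" unfolding t_def using neg by (intro divide_pos_pos) auto
    have "0 \<le> w \<bullet> h undefined + w \<bullet> ((\<chi> i. 1) + axis k t)"
      using t by (intro above) (auto simp: axis_def add_pos_nonneg)
    also have "\<dots> = S + w $ k * t"
      by (simp add: S_def inner_add_right inner_axis)
    also have "w $ k * t = - (\<bar>S\<bar> + 1)"
      using neg by (simp add: t_def field_simps)
    finally show False by linarith
  qed
  have "0 \<le> w \<bullet> h x" for x
  proof (rule field_le_epsilon)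
    fix e :: real
    assume e: "0 < e"
    define W where "W = w \<bullet> (\<chi> i. 1)"
    have W: "0 \<le> W"
      using nonneg by (simp add: W_def inner_vec_def sum_nonneg)
    have "0 \<le> w \<bullet> h x + w \<bullet> ((e / (W + 1)) *\<^sub>R (\<chi> i. 1))"
      using e W by (intro above) simp
    also have "\<dots> = w \<bullet> h x + e * (W / (W + 1))"
      by (simp add: W_def)
    also have "\<dots> \<le> w \<bullet> h x + e"
      using e W by (simp add: pos_divide_le_eq distrib_left)
    finally show "0 \<le> w \<bullet> h x + e" .
  qed
  then show thesis
    using that[of w] w(1) nonneg by (simp add: inner_vec_def)
qed

text \<open>
  At a Slater point a combination of the constraints alone with nonzero nonnegative weights is negative,
  so some objective carries positive weight and the weights of the objectives can be scaled to sum
  to one. The two families are stacked into one vector indexed by \<open>'m + 'l\<close>.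
\<close>

lemma convex_alternative_slater:
  fixes F :: "'a::real_vector \<Rightarrow> real^'m" and G :: "'a \<Rightarrow> real^'l"
  assumes F: "\<And>j. convex_on UNIV (\<lambda>x. F x $ j)"
    and G: "\<And>r. convex_on UNIV (\<lambda>x. G x $ r)"
    and slater: "\<And>r. G xs $ r < 0"
    and inconsistent: "\<And>x. (\<And>r. G x $ r \<le> 0) \<Longrightarrow> \<exists>j. 0 \<le> F x $ j"
  obtains \<tau> \<mu> where "\<tau> \<in> unit_simplex" "\<mu> \<in> nonneg_orthant"
    "\<And>x. 0 \<le> (\<Sum>j\<in>UNIV. \<tau> $ j * F x $ j) + (\<Sum>r\<in>UNIV. \<mu> $ r * G x $ r)"
proof -
  define h :: "'a \<Rightarrow> real^('m + 'l)"
    where "h x = (\<chi> k. case k of Inl j \<Rightarrow> F x $ j | Inr r \<Rightarrow> G x $ r)" for x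
  have h [simp]: "h x $ Inl j = F x $ j" "h x $ Inr r = G x $ r" for x j r
    by (simp_all add: h_def)
  have conv: "convex_on UNIV (\<lambda>x. h x $ k)" for k
    by (cases k) (simp_all add: F G)
  have "\<not> (\<exists>x. \<forall>k. h x $ k < 0)"
  proof
    assume "\<exists>x. \<forall>k. h x $ k < 0"
    then obtain x where x: "\<And>k. h x $ k < 0" by blast
    have "G x $ r \<le> 0" for r using x[of "Inr r"] by simp
    then obtain j where "0 \<le> F x $ j" using inconsistent by blast
    then show False using x[of "Inl j"] by simp
  qed
  then obtain w where w: "w \<noteq> 0" "\<And>k. 0 \<le> w $ k" "\<And>x. 0 \<le> (\<Sum>k\<in>UNIV. w $ k * h x $ k)"
    using convex_alternative[OF conv] by blast
  have split: "0 \<le> (\<Sum>j\<in>UNIV. w $ Inl j * F x $ j) + (\<Sum>r\<in>UNIV. w $ Inr r * G x $ r)" for x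
    using w(3)[of x] sum.Plus[of "UNIV :: 'm set" "UNIV :: 'l set" "\<lambda>k. w $ k * h x $ k"] by simp
  define T where "T = (\<Sum>j\<in>UNIV. w $ Inl j)"
  have le_T: "w $ Inl j \<le> T" for j
    unfolding T_def by (intro member_le_sum) (auto simp: w)
  have T: "0 < T"
  proof (rule ccontr)
    assume "\<not> 0 < T"
    then have Inl0: "w $ Inl j = 0" for j
      using le_T[of j] w(2)[of "Inl j"] by linarith
    have nonpos: "w $ Inr r * G xs $ r \<le> 0" for r
      using w(2) slater[of r] by (simp add: mult_nonneg_nonpos)
    moreover have "0 \<le> (\<Sum>r\<in>UNIV. w $ Inr r * G xs $ r)"
      using split[of xs] Inl0 by simp
    ultimately have "(\<Sum>r\<in>UNIV. w $ Inr r * G xs $ r) = 0"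
      by (meson order_antisym sum_nonpos)
    then have "w $ Inr r * G xs $ r = 0" for r
      using sum_nonneg_eq_0_iff[of UNIV "\<lambda>r. - (w $ Inr r * G xs $ r)"] nonpos
      by (simp add: sum_negf)
    then have "w $ Inr r = 0" for r
      using slater[of r] by (metis less_irrefl mult_eq_0_iff)
    then have "w $ k = 0" for k
      using Inl0 by (cases k) auto
    then show False
      using w(1) by (simp add: vec_eq_iff)
  qed
  show thesis
  proof
    show "(\<chi> j. w $ Inl j / T) \<in> unit_simplex"
      using w(2) le_T T
      by (simp add: unit_simplex_def sum_divide_distrib[symmetric] flip: T_def)
    show "(\<chi> r. w $ Inr r / T) \<in> nonneg_orthant"
      using w(2) T by (simp add: nonneg_orthant_def)
    fix x
    show "0 \<le> (\<Sum>j\<in>UNIV. (\<chi> j. w $ Inl j / T) $ j * F x $ j)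
            + (\<Sum>r\<in>UNIV. (\<chi> r. w $ Inr r / T) $ r * G x $ r)"
      using divide_nonneg_pos[OF split[of x] T]
      by (simp add: add_divide_distrib sum_divide_distrib)
  qed
qed

section \<open>Properness as a weighted inequality\<close>

text \<open>
  The objectives handed to the theorem of the alternative are \<open>F x $ j = d x i + M * d x j\<close> for
  \<open>j \<noteq> i\<close> and \<open>F x $ i = d x i\<close>; all of them being negative at a feasible point contradicts properness.
  The summand \<open>d x i\<close> common to all objectives receives the total weight of \<open>\<tau>\<close>.
\<close>

lemma geoffrion_proper_multipliers:
  fixes f :: "real^'n \<Rightarrow> real^'m" and g :: "real^'n \<Rightarrow> real^'l"
  assumes f: "\<And>i. convex_on UNIV (\<lambda>x. f x $ i)"
    and g: "\<And>r. convex_on UNIV (\<lambda>x. g x $ r)"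
    and M: "0 < M"
    and slater: "slater_cq g"
    and proper: "x0 \<in> geoffrion_proper M \<epsilon> f (feasible_set g)"
  obtains \<tau> \<mu> where "\<tau> \<in> unit_simplex" "\<mu> \<in> nonneg_orthant"
    "\<And>x. 0 \<le> (f x $ i - f x0 $ i + \<epsilon> $ i)
        + (\<Sum>j\<in>UNIV - {i}. \<tau> $ j * M * (f x $ j - f x0 $ j + \<epsilon> $ j))
        + (\<Sum>r\<in>UNIV. \<mu> $ r * g x $ r)"
proof -
  define d where "d x j = f x $ j - f x0 $ j + \<epsilon> $ j" for x j
  define F where "F x = (\<chi> j. d x i + (if j = i then 0 else M * d x j))" for x
  have d_convex: "convex_on UNIV (\<lambda>x. d x j)" for j
  proof -
    have "convex_on UNIV (\<lambda>x. f x $ j + (\<epsilon> $ j - f x0 $ j))"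
      by (intro convex_on_add f) (simp add: convex_on_const)
    then show ?thesis
      by (simp add: d_def algebra_simps)
  qed
  have F_convex: "convex_on UNIV (\<lambda>x. F x $ j)" for j
    using M convex_on_add[OF d_convex convex_on_cmul[OF _ d_convex]] d_convex by (cases "j = i") (simp_all add: F_def)
  obtain xs where xs: "\<And>r. g xs $ r < 0"
    using slater unfolding slater_cq_def by blast
  have inconsistent: "\<exists>j. 0 \<le> F x $ j" if "\<And>r. g x $ r \<le> 0" for x
  proof (rule ccontr)
    assume "\<not> (\<exists>j. 0 \<le> F x $ j)"
    then have F_neg: "F x $ j < 0" for j
      by (simp add: not_le)
    have di: "d x i < 0"
      using F_neg[of i] by (simp add: F_def)
    then have "f x $ i < f x0 $ i - \<epsilon> $ i"
      by (simp add: d_def)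
    moreover have "x \<in> feasible_set g"
      using that by (simp add: feasible_set_def)
    ultimately obtain j where j: "f x0 $ j - \<epsilon> $ j < f x $ j"
      "(f x0 $ i - f x $ i - \<epsilon> $ i) / (f x $ j - f x0 $ j + \<epsilon> $ j) \<le> M"
      using proper unfolding geoffrion_proper_def by blast
    then have dj: "0 < d x j" and "- d x i / d x j \<le> M"
      by (simp_all add: d_def algebra_simps)
    then have "0 \<le> d x i + M * d x j"
      by (simp add: field_simps)
    moreover have "j \<noteq> i"
      using di dj by auto
    ultimately show False
      using F_neg[of j] by (simp add: F_def)
  qed
  obtain \<tau> \<mu> where \<tau>: "\<tau> \<in> unit_simplex" and \<mu>: "\<mu> \<in> nonneg_orthant"
    and pos: "\<And>x. 0 \<le> (\<Sum>j\<in>UNIV. \<tau> $ j * F x $ j) + (\<Sum>r\<in>UNIV. \<mu> $ r * g x $ r)"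
    using convex_alternative_slater[OF F_convex g xs inconsistent] by blast
  have "(\<Sum>j\<in>UNIV. \<tau> $ j * F x $ j) = d x i + (\<Sum>j\<in>UNIV - {i}. \<tau> $ j * M * d x j)" for x
  proof -
    have "(\<Sum>j\<in>UNIV. \<tau> $ j * F x $ j) =
        (\<Sum>j\<in>UNIV. \<tau> $ j) * d x i + (\<Sum>j\<in>UNIV. if j = i then 0 else \<tau> $ j * M * d x j)"
      unfolding sum_distrib_right sum.distrib[symmetric]
      by (intro sum.cong) (auto simp: F_def algebra_simps)
    also have "(\<Sum>j\<in>UNIV. if j = i then 0 else \<tau> $ j * M * d x j) =
        (\<Sum>j\<in>UNIV - {i}. \<tau> $ j * M * d x j)"
      by (intro sum.mono_neutral_cong_right) auto
    finally show ?thesis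
      using \<tau> by (simp add: unit_simplex_def)
  qed
  then show thesis
    using that[OF \<tau> \<mu>] pos by (simp add: d_def)
qed

text \<open>
  With \<open>c j = - d i - M * d j\<close> for \<open>j \<noteq> i\<close> and \<open>c i = - d i\<close>, the weighted inequality says that the
  average of \<open>c\<close> under \<open>\<tau>\<close> is at most zero, so \<open>c\<close> cannot be positive throughout.
\<close>

lemma simplex_weighted_tradeoff:
  fixes d :: "'m::finite \<Rightarrow> real"
  assumes \<tau>: "\<tau> \<in> unit_simplex"
    and weighted: "0 \<le> d i + (\<Sum>j\<in>UNIV - {i}. \<tau> $ j * M * d j)"
    and neg: "d i < 0"
  obtains j where "j \<noteq> i" "- d i \<le> M * d j"
proof -
  have \<tau>_nonneg: "0 \<le> \<tau> $ j" and \<tau>_sum: "(\<Sum>j\<in>UNIV. \<tau> $ j) = 1" for j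
    using \<tau> by (simp_all add: unit_simplex_def)
  have "\<exists>j. j \<noteq> i \<and> - d i \<le> M * d j"
  proof (rule ccontr)
    assume none: "\<not> (\<exists>j. j \<noteq> i \<and> - d i \<le> M * d j)"
    define c where "c j = - d i - (if j = i then 0 else M * d j)" for j
    have c_pos: "0 < c j" for j
      using none neg by (auto simp: c_def not_le)
    have "\<exists>j. \<tau> $ j \<noteq> 0"
      using \<tau>_sum by (metis sum.neutral zero_neq_one)
    then obtain k where "0 < \<tau> $ k"
      using \<tau>_nonneg by (metis less_eq_real_def)
    then have "0 < (\<Sum>j\<in>UNIV. \<tau> $ j * c j)"
      using \<tau>_nonneg c_pos by (intro sum_pos2[of _ k]) (auto simp: less_imp_le)
    also have "(\<Sum>j\<in>UNIV. \<tau> $ j * c j) =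
        (\<Sum>j\<in>UNIV. \<tau> $ j) * - d i - (\<Sum>j\<in>UNIV. if j = i then 0 else \<tau> $ j * M * d j)"
      unfolding sum_distrib_right sum_subtractf[symmetric]
      by (intro sum.cong) (auto simp: c_def algebra_simps)
    also have "(\<Sum>j\<in>UNIV. if j = i then 0 else \<tau> $ j * M * d j) =
        (\<Sum>j\<in>UNIV - {i}. \<tau> $ j * M * d j)"
      by (intro sum.mono_neutral_cong_right) auto
    finally show False
      using weighted \<tau>_sum by simp
  qed
  then show thesis
    using that by blast
qed

lemma eps_paretoI:
  assumes "x0 \<in> X"
    and "\<And>x i. x \<in> X \<Longrightarrow> (\<And>j. f x $ j - f x0 $ j + \<epsilon> $ j \<le> 0) \<Longrightarrow> 0 \<le> f x $ i - f x0 $ i + \<epsilon> $ i"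
  shows "x0 \<in> eps_pareto \<epsilon> f X"
proof -
  have "f x + \<epsilon> - f x0 = 0" if x: "x \<in> X" and below: "f x + \<epsilon> - f x0 \<in> uminus ` nonneg_orthant" for x
  proof -
    obtain v where v: "\<And>j. 0 \<le> v $ j" "f x + \<epsilon> - f x0 = - v"
      using below by (auto simp: nonneg_orthant_def)
    then have d: "f x $ j - f x0 $ j + \<epsilon> $ j = - v $ j" for j
      by (simp add: vec_eq_iff algebra_simps)
    have "0 \<le> f x $ i - f x0 $ i + \<epsilon> $ i" for i
      using d v(1) by (intro assms(2) x) simp
    then have "v $ i = 0" for i
      using d[of i] v(1)[of i] by (metis neg_0_le_iff_le order_antisym)
    then show ?thesis
      using v(2) by (simp add: vec_eq_iff)
  qed
  then show ?thesis
    using assms(1) by (auto simp: eps_pareto_def)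
qed

text \<open>
  Both parts of properness come from one fact: wherever \<open>d i < 0\<close>, some \<open>d j\<close> with \<open>j \<noteq> i\<close> is
  positive and at least \<open>- d i / M\<close>.
\<close>

lemma geoffrion_properI_weighted:
  fixes f :: "real^'n \<Rightarrow> real^'m"
  assumes M: "0 < M"
    and M': "(1 + M) * (real CARD('m) - 1) \<le> M'"
    and x0: "x0 \<in> X"
    and weighted: "\<And>i. \<exists>\<tau>\<in>unit_simplex. \<forall>x\<in>X.
      0 \<le> (f x $ i - f x0 $ i + \<epsilon> $ i)
        + (\<Sum>j\<in>UNIV - {i}. \<tau> $ j * M * (f x $ j - f x0 $ j + \<epsilon> $ j))"
  shows "x0 \<in> geoffrion_proper M' \<epsilon> f X"
proof -
  define d where "d x j = f x $ j - f x0 $ j + \<epsilon> $ j" for x j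
  have gain: "\<exists>j. j \<noteq> i \<and> - d x i \<le> M * d x j" if x: "x \<in> X" and neg: "d x i < 0" for x i
  proof -
    obtain \<tau> where "\<tau> \<in> unit_simplex" "0 \<le> d x i + (\<Sum>j\<in>UNIV - {i}. \<tau> $ j * M * d x j)"
      using weighted[of i] x unfolding d_def by blast
    then show ?thesis
      using simplex_weighted_tradeoff[of \<tau> "d x" i M] neg by blast
  qed
  have gain_pos: "0 < d x j" if "d x i < 0" "- d x i \<le> M * d x j" for x i j
    using that M by (metis neg_0_less_iff_less order_less_le_trans zero_less_mult_pos)
  have "x0 \<in> eps_pareto \<epsilon> f X"
  proof (rule eps_paretoI[OF x0])
    fix x i
    assume x: "x \<in> X" and all: "\<And>j. f x $ j - f x0 $ j + \<epsilon> $ j \<le> 0"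
    show "0 \<le> f x $ i - f x0 $ i + \<epsilon> $ i"
    proof (rule ccontr)
      assume "\<not> ?thesis"
      then have "d x i < 0"
        by (simp add: d_def)
      then obtain j where "0 < d x j"
        using gain[OF x] gain_pos by blast
      then show False
        using all[of j] by (simp add: d_def)
    qed
  qed
  moreover have "\<exists>j. f x0 $ j - \<epsilon> $ j < f x $ j \<and>
      (f x0 $ i - f x $ i - \<epsilon> $ i) / (f x $ j - f x0 $ j + \<epsilon> $ j) \<le> M'"
    if x: "x \<in> X" and less: "f x $ i < f x0 $ i - \<epsilon> $ i" for x i
  proof -
    have neg: "d x i < 0"
      using less by (simp add: d_def)
    then obtain j where j: "j \<noteq> i" "- d x i \<le> M * d x j"
      using gain[OF x] by blast
    have pos: "0 < d x j"
      using gain_pos[OF neg j(2)] .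
    \<comment> \<open>The two distinct indices \<open>i\<close> and \<open>j\<close> make the factor \<open>m - 1\<close> at least one.\<close>
    have "card {i, j} \<le> CARD('m)"
      by (intro card_mono) auto
    then have "1 \<le> real CARD('m) - 1"
      using j(1) by simp
    then have "(1 + M) * 1 \<le> (1 + M) * (real CARD('m) - 1)"
      using M by (intro mult_left_mono) auto
    then have "M \<le> M'"
      using M' by simp
    moreover have "- d x i / d x j \<le> M"
      unfolding pos_divide_le_eq[OF pos] using j(2) .
    ultimately have "- d x i / d x j \<le> M'"
      by linarith
    then show ?thesis
      using pos by (intro exI[of _ j]) (simp add: d_def algebra_simps)
  qed
  ultimately show ?thesis
    unfolding geoffrion_proper_def by blast
qed

section \<open>Approximate saddle points\<close>

text \<open>
  This turns the right-hand saddle inequality into the weighted inequality for the shifted increments: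
  \<open>c = 1\<close> serves the necessity of the conditions and \<open>c = 2\<close>, with its second \<open>eps_bar\<close> absorbing the
  approximate slackness, their sufficiency.
\<close>

lemma lagrangian_diff:
  "lagrangian f g M i x \<tau> \<mu> - lagrangian f g M i y \<tau> \<nu> + c * eps_bar M \<epsilon> \<tau> i =
     (f x $ i - f y $ i + c * \<epsilon> $ i)
     + (\<Sum>j\<in>UNIV - {i}. \<tau> $ j * M * (f x $ j - f y $ j + c * \<epsilon> $ j))
     + ((\<Sum>r\<in>UNIV. \<mu> $ r * g x $ r) - (\<Sum>r\<in>UNIV. \<nu> $ r * g y $ r))"
proof -
  have "(\<Sum>j\<in>UNIV - {i}. \<tau> $ j * M * (f x $ j - f y $ j + c * \<epsilon> $ j)) =
      (\<Sum>j\<in>UNIV - {i}. \<tau> $ j * M * f x $ j) - (\<Sum>j\<in>UNIV - {i}. \<tau> $ j * M * f y $ j)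
      + c * (\<Sum>j\<in>UNIV - {i}. \<tau> $ j * M * \<epsilon> $ j)"
    by (simp add: sum_subtractf sum.distrib sum_distrib_left algebra_simps)
  then show ?thesis
    by (simp add: lagrangian_def eps_bar_def algebra_simps)
qed

text \<open>
  A violated constraint would let its own multiplier drive the Lagrangian above any bound.
\<close>

lemma saddle_imp_feasible:
  assumes \<mu>b: "\<mu>b \<in> nonneg_orthant"
    and saddle: "\<And>\<mu>. \<mu> \<in> nonneg_orthant \<Longrightarrow>
      lagrangian f g M i x0 \<tau> \<mu> - e \<le> lagrangian f g M i x0 \<tau> \<mu>b"
  shows "x0 \<in> feasible_set g"
proof -
  have "g x0 $ r \<le> 0" for r
  proof (rule ccontr)
    assume "\<not> g x0 $ r \<le> 0"
    then have pos: "0 < g x0 $ r" by simp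
    define t where "t = (\<bar>e\<bar> + 1) / g x0 $ r"
    have "\<mu>b + axis r t \<in> nonneg_orthant"
      using \<mu>b pos by (simp add: nonneg_orthant_def axis_def t_def)
    moreover have "(\<Sum>s\<in>UNIV. (\<mu>b + axis r t) $ s * g x0 $ s) =
        (\<Sum>s\<in>UNIV. \<mu>b $ s * g x0 $ s) + t * g x0 $ r"
      using inner_axis'[of r t "g x0"]
      by (simp add: inner_vec_def distrib_right sum.distrib)
    ultimately have "t * g x0 $ r \<le> e"
      using saddle[of "\<mu>b + axis r t"] unfolding lagrangian_def by linarith
    then show False
      using pos by (simp add: t_def)
  qed
  then show ?thesis
    by (simp add: feasible_set_def)
qed

lemma constraint_sum_nonpos:
  assumes "\<mu> \<in> nonneg_orthant" "x \<in> feasible_set g"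
  shows "(\<Sum>r\<in>UNIV. \<mu> $ r * g x $ r) \<le> 0"
  using assms
  by (intro sum_nonpos) (auto simp: nonneg_orthant_def feasible_set_def mult_nonneg_nonpos)

theorem theorem4p6:
  fixes f :: "real^'n \<Rightarrow> real^'m"
    and g :: "real^'n \<Rightarrow> real^'l"
    and \<epsilon> :: "real^'m"
    and M :: real
  assumes "\<And>i. convex_on UNIV (\<lambda>x. f x $ i)"
    and "\<And>r. convex_on UNIV (\<lambda>x. g x $ r)"
    and "\<epsilon> \<in> nonneg_orthant"
    and "M > 0"
    and "slater_cq g"
  shows "(\<forall>x0 \<in> geoffrion_proper M \<epsilon> f (feasible_set g).
            \<forall>i. \<exists>\<tau>\<in>unit_simplex. \<exists>\<mu>b\<in>nonneg_orthant.
              (\<forall>x. \<forall>\<mu>\<in>nonneg_orthant.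
                 lagrangian f g M i x0 \<tau> \<mu> - eps_bar M \<epsilon> \<tau> i \<le> lagrangian f g M i x0 \<tau> \<mu>b \<and>
                 lagrangian f g M i x0 \<tau> \<mu>b \<le> lagrangian f g M i x \<tau> \<mu>b + eps_bar M \<epsilon> \<tau> i) \<and>
              (\<Sum>r\<in>UNIV. \<mu>b $ r * g x0 $ r) \<ge> - eps_bar M \<epsilon> \<tau> i)
       \<and> (\<forall>x0.
            (\<forall>i. \<exists>\<tau>\<in>unit_simplex. \<exists>\<mu>b\<in>nonneg_orthant.
              (\<forall>x. \<forall>\<mu>\<in>nonneg_orthant.
                 lagrangian f g M i x0 \<tau> \<mu> - eps_bar M \<epsilon> \<tau> i \<le> lagrangian f g M i x0 \<tau> \<mu>b \<and>
                 lagrangian f g M i x0 \<tau> \<mu>b \<le> lagrangian f g M i x \<tau> \<mu>b + eps_bar M \<epsilon> \<tau> i) \<and>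
              (\<Sum>r\<in>UNIV. \<mu>b $ r * g x0 $ r) \<ge> - eps_bar M \<epsilon> \<tau> i)
            \<longrightarrow> (\<forall>M'>0. M' \<ge> (1 + M) * (real CARD('m) - 1)
                   \<longrightarrow> x0 \<in> geoffrion_proper M' (2 *\<^sub>R \<epsilon>) f (feasible_set g)))"
proof (intro conjI ballI allI impI)
  fix x0 i
  assume proper: "x0 \<in> geoffrion_proper M \<epsilon> f (feasible_set g)"
  then have feasible: "x0 \<in> feasible_set g"
    by (simp add: geoffrion_proper_def eps_pareto_def)
  obtain \<tau> \<mu>b where \<tau>: "\<tau> \<in> unit_simplex" and \<mu>b: "\<mu>b \<in> nonneg_orthant"
    and pos: "\<And>x. 0 \<le> (f x $ i - f x0 $ i + \<epsilon> $ i)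
        + (\<Sum>j\<in>UNIV - {i}. \<tau> $ j * M * (f x $ j - f x0 $ j + \<epsilon> $ j))
        + (\<Sum>r\<in>UNIV. \<mu>b $ r * g x $ r)"
    using geoffrion_proper_multipliers[OF assms(1,2,4,5) proper] by blast
  have slack: "- eps_bar M \<epsilon> \<tau> i \<le> (\<Sum>r\<in>UNIV. \<mu>b $ r * g x0 $ r)"
    using pos[of x0] by (simp add: eps_bar_def)
  have left: "lagrangian f g M i x0 \<tau> \<mu> - eps_bar M \<epsilon> \<tau> i \<le> lagrangian f g M i x0 \<tau> \<mu>b"
    if "\<mu> \<in> nonneg_orthant" for \<mu>
    using constraint_sum_nonpos[OF that feasible] slack unfolding lagrangian_def by linarith
  have right: "lagrangian f g M i x0 \<tau> \<mu>b \<le> lagrangian f g M i x \<tau> \<mu>b + eps_bar M \<epsilon> \<tau> i" for x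
    using lagrangian_diff[of f g M i x \<tau> \<mu>b x0 \<mu>b 1 \<epsilon>] pos[of x]
      constraint_sum_nonpos[OF \<mu>b feasible] by simp
  show "\<exists>\<tau>\<in>unit_simplex. \<exists>\<mu>b\<in>nonneg_orthant.
      (\<forall>x. \<forall>\<mu>\<in>nonneg_orthant.
         lagrangian f g M i x0 \<tau> \<mu> - eps_bar M \<epsilon> \<tau> i \<le> lagrangian f g M i x0 \<tau> \<mu>b \<and>
         lagrangian f g M i x0 \<tau> \<mu>b \<le> lagrangian f g M i x \<tau> \<mu>b + eps_bar M \<epsilon> \<tau> i) \<and>
      (\<Sum>r\<in>UNIV. \<mu>b $ r * g x0 $ r) \<ge> - eps_bar M \<epsilon> \<tau> i"
    using \<tau> \<mu>b slack left right by blast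
next
  fix x0 and M' :: real
  assume saddle: "\<forall>i. \<exists>\<tau>\<in>unit_simplex. \<exists>\<mu>b\<in>nonneg_orthant.
      (\<forall>x. \<forall>\<mu>\<in>nonneg_orthant.
         lagrangian f g M i x0 \<tau> \<mu> - eps_bar M \<epsilon> \<tau> i \<le> lagrangian f g M i x0 \<tau> \<mu>b \<and>
         lagrangian f g M i x0 \<tau> \<mu>b \<le> lagrangian f g M i x \<tau> \<mu>b + eps_bar M \<epsilon> \<tau> i) \<and>
      (\<Sum>r\<in>UNIV. \<mu>b $ r * g x0 $ r) \<ge> - eps_bar M \<epsilon> \<tau> i"
    and M': "(1 + M) * (real CARD('m) - 1) \<le> M'"
  have feasible: "x0 \<in> feasible_set g"
    using saddle saddle_imp_feasible by blast
  have "\<exists>\<tau>\<in>unit_simplex. \<forall>x\<in>feasible_set g.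
      0 \<le> (f x $ i - f x0 $ i + (2 *\<^sub>R \<epsilon>) $ i)
        + (\<Sum>j\<in>UNIV - {i}. \<tau> $ j * M * (f x $ j - f x0 $ j + (2 *\<^sub>R \<epsilon>) $ j))" for i
  proof -
    obtain \<tau> \<mu>b where \<tau>: "\<tau> \<in> unit_simplex" and \<mu>b: "\<mu>b \<in> nonneg_orthant"
      and right: "\<And>x. lagrangian f g M i x0 \<tau> \<mu>b \<le> lagrangian f g M i x \<tau> \<mu>b + eps_bar M \<epsilon> \<tau> i"
      and slack: "- eps_bar M \<epsilon> \<tau> i \<le> (\<Sum>r\<in>UNIV. \<mu>b $ r * g x0 $ r)"
      using saddle by blast
    have "0 \<le> (f x $ i - f x0 $ i + 2 * \<epsilon> $ i)
        + (\<Sum>j\<in>UNIV - {i}. \<tau> $ j * M * (f x $ j - f x0 $ j + 2 * \<epsilon> $ j))"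
      if "x \<in> feasible_set g" for x
      using lagrangian_diff[of f g M i x \<tau> \<mu>b x0 \<mu>b 2 \<epsilon>] right[of x] slack
        constraint_sum_nonpos[OF \<mu>b that] by linarith
    then show ?thesis
      using \<tau> by auto
  qed
  then show "x0 \<in> geoffrion_proper M' (2 *\<^sub>R \<epsilon>) f (feasible_set g)"
    by (intro geoffrion_properI_weighted[OF assms(4) M' feasible]) auto
qed

end
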